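(* Let $\hat{A}\in\mathbb{DC}^{n\times n}$, and let $\hat{U},\hat{\Sigma}_1,\hat{\Sigma}_2,\hat{K},\hat{L},\hat{M},\hat{N}$ be a Hartwig-Spindelböck decomposition of $\hat{A}$ (as defined in the context), with $\hat{\Sigma}_1=\Sigma_{1s}+\Sigma_{1d}\epsilon$, $\hat{\Sigma}_2=\Sigma_{2d}\epsilon$, $\hat{L}=L_s+L_d\epsilon$, $\hat{M}=M_s+M_d\epsilon$, $\hat{N}=N_s+N_d\epsilon$. Then: (i) $\hat{A}$ is Hermitian if and only if $\hat{K}^*\hat{\Sigma}_1=\hat{\Sigma}_1\hat{K}$, $N_s^*\Sigma_{2d}=\Sigma_{2d}N_s$ and $\hat{L}=(\Sigma_{1s}^{-1}M_s^*\Sigma_{2d})\epsilon$. (ii) $\hat{A}$ is new dual EP if and only if $\hat{L}=O$. (iii) $\hat{A}$ is normal if and only if $\hat{L}=O$ and $\hat{\Sigma}_1\hat{K}=\hat{K}\hat{\Sigma}_1$. (iv) $\hat{A}^*=\hat{A}^N$ if and only if $\Sigma_{2d}M_s=O$, $\Sigma_{2d}N_s=O$ and $\hat{\Sigma}_1=I$. (v) $\hat{A}^N$ is idempotent if and only if $\hat{\Sigma}_1=\hat{K}$. (vi) $\hat{A}^N\hat{A}^*=\hat{A}^*\hat{A}^N$ if and only if $\Sigma_{2d}M_s=O$, $L_s\Sigma_{2d}N_s=O$ and $\hat{\Sigma}_1^2\hat{K}=\hat{K}\hat{\Sigma}_1^2$.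
   Context: $\mathbb{D}$ is the ring of dual numbers $\hat a=a_s+a_d\epsilon$ with $a_s,a_d\in\mathbb{R}$ and $\epsilon^2=0$; $\mathbb{DC}$ is the ring of dual complex numbers, defined in the same way with $a_s,a_d\in\mathbb{C}$. A dual number is appreciable if $a_s\ne0$ and infinitesimal if $a_s=0$. $\mathbb{D}$ is totally ordered by: $\hat a<\hat b$ iff $a_s<b_s$, or $a_s=b_s$ and $a_d<b_d$. Every $\hat{A}\in\mathbb{DC}^{m\times n}$ is written $\hat{A}=A_s+A_d\epsilon$ with $A_s,A_d$ complex matrices, and $\hat{A}^*=A_s^*+A_d^*\epsilon$ (conjugate transpose). $\hat{U}$ is unitary if $\hat{U}^*\hat{U}=\hat{U}\hat{U}^*=I$. SVD (known theorem): every $\hat{A}\in\mathbb{DC}^{m\times n}$ can be written $\hat{A}=\hat{U}\begin{bmatrix}\hat{\Sigma}_1&O\\O&\hat{\Sigma}_2\end{bmatrix}\hat{V}^*$ with $\hat{U}\in\mathbb{DC}^{m\times m}$, $\hat{V}\in\mathbb{DC}^{n\times n}$ unitary, $\hat{\Sigma}_1=\mathrm{diag}(\hat{\mu}_1,\dots,\hat{\mu}_r)$ with $\hat{\mu}_1\ge\dots\ge\hat{\mu}_r$ positive appreciable dual numbers, and $\hat{\Sigma}_2=\mathrm{diag}(\hat{\mu}_{r+1},\dots,\hat{\mu}_t,0,\dots,0)$ of size $(m-r)\times(n-r)$ with $\hat{\mu}_{r+1}\ge\dots\ge\hat{\mu}_t$ positive infinitesimal dual numbers. The essential part of $\hat{A}$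 is $A_e=\hat{U}\begin{bmatrix}\hat{\Sigma}_1&O\\O&O\end{bmatrix}\hat{V}^*$ (it does not depend on the chosen SVD). Hartwig-Spindelböck decomposition of $\hat{A}\in\mathbb{DC}^{n\times n}$: a unitary $\hat{U}\in\mathbb{DC}^{n\times n}$, diagonal matrices $\hat{\Sigma}_1=\mathrm{diag}(\hat{\mu}_1,\dots,\hat{\mu}_r)\in\mathbb{D}^{r\times r}$ with $\hat{\mu}_1\ge\dots\ge\hat{\mu}_r>0$ appreciable and $\hat{\Sigma}_2=\mathrm{diag}(\hat{\mu}_{r+1},\dots,\hat{\mu}_t,0,\dots,0)\in\mathbb{D}^{(n-r)\times(n-r)}$ with $\hat{\mu}_{r+1}\ge\dots\ge\hat{\mu}_t>0$ infinitesimal, and matrices $\hat{K}\in\mathbb{DC}^{r\times r}$, $\hat{L}\in\mathbb{DC}^{r\times(n-r)}$, $\hat{M}\in\mathbb{DC}^{(n-r)\times r}$, $\hat{N}\in\mathbb{DC}^{(n-r)\times(n-r)}$ with $\hat{K}\hat{K}^*+\hat{L}\hat{L}^*=I_r$, $\hat{K}\hat{M}^*+\hat{L}\hat{N}^*=O$, such that $\hat{A}=\hat{U}\begin{bmatrix}\hat{\Sigma}_1\hat{K}&\hat{\Sigma}_1\hat{L}\\ \hat{\Sigma}_2\hat{M}&\hat{\Sigma}_2\hat{N}\end{bmatrix}\hat{U}^*$ and $A_e=\hat{U}\begin{bmatrix}\hat{\Sigma}_1\hat{K}&\hat{\Sigma}_1\hat{L}\\ O&O\end{bmatrix}\hat{U}^*$.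 Such a decomposition always exists. The NDMPI (new dual Moore-Penrose inverse) $\hat{A}^N$ of $\hat{A}$ is the unique $\hat{X}$ with $\hat{A}\hat{X}\hat{A}=A_e$, $\hat{X}\hat{A}\hat{X}=\hat{X}$, $(\hat{A}\hat{X})^*=\hat{A}\hat{X}$, $(\hat{X}\hat{A})^*=\hat{X}\hat{A}$; it always exists. A matrix $\hat{A}\in\mathbb{DC}^{n\times n}$ is Hermitian if $\hat{A}^*=\hat{A}$, idempotent if $\hat{A}^2=\hat{A}$, normal if $\hat{A}\hat{A}^*=\hat{A}^*\hat{A}$, and new dual EP if $\hat{A}\hat{A}^N=\hat{A}^N\hat{A}$. *)

theory Defs
  imports
    "Jordan_Normal_Form.Gauss_Jordan_Elimination"
    "Jordan_Normal_Form.Schur_Decomposition"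
begin

section \<open>Dual numbers\<close>

text \<open>\<open>Dual a b\<close> stands for \<open>a + b \<epsilon>\<close> with \<open>\<epsilon>\<^sup>2 = 0\<close>.
  The ring D is \<open>real dual\<close> and the ring DC is \<open>complex dual\<close>.\<close>

datatype 'a dual = Dual (std_part: 'a) (dual_part: 'a)

lemma dual_eq_iff: "a = b \<longleftrightarrow> std_part a = std_part b \<and> dual_part a = dual_part b"
  by (auto intro: dual.expand)

instantiation dual :: (zero) zero
begin
definition zero_dual :: "'a dual" where "0 = Dual 0 0"
instance ..
end

instantiation dual :: ("{zero,one}") one
begin
definition one_dual :: "'a dual" where "1 = Dual 1 0"
instance ..
end

instantiation dual :: (plus) plus
begin
definition plus_dual :: "'a dual \<Rightarrow> 'a dual \<Rightarrow> 'a dual" where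
  "a + b = Dual (std_part a + std_part b) (dual_part a + dual_part b)"
instance ..
end

instantiation dual :: (minus) minus
begin
definition minus_dual :: "'a dual \<Rightarrow> 'a dual \<Rightarrow> 'a dual" where
  "a - b = Dual (std_part a - std_part b) (dual_part a - dual_part b)"
instance ..
end

instantiation dual :: (uminus) uminus
begin
definition uminus_dual :: "'a dual \<Rightarrow> 'a dual" where
  "- a = Dual (- std_part a) (- dual_part a)"
instance ..
end

instantiation dual :: ("{plus,times}") times
begin
definition times_dual :: "'a dual \<Rightarrow> 'a dual \<Rightarrow> 'a dual" where
  "a * b = Dual (std_part a * std_part b)
                (std_part a * dual_part b + dual_part a * std_part b)"
instance ..
end

lemmas dual_ring_defs =
  zero_dual_def one_dual_def plus_dual_def minus_dual_def uminus_dual_def times_dual_def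

instance dual :: (ab_group_add) ab_group_add
  by standard (auto simp: dual_ring_defs algebra_simps)

instance dual :: (ring) ring
  by standard (auto simp: dual_ring_defs algebra_simps)

instance dual :: (comm_ring) comm_ring
  by standard (auto simp: dual_ring_defs algebra_simps)

instance dual :: (ring_1) ring_1
  by standard (auto simp: dual_ring_defs)

instance dual :: (comm_ring_1) comm_ring_1
  by standard (auto simp: dual_ring_defs)

instantiation dual :: (linorder) linorder
begin

definition less_dual :: "'a dual \<Rightarrow> 'a dual \<Rightarrow> bool" where
  "a < b \<longleftrightarrow> std_part a < std_part b \<or> std_part a = std_part b \<and> dual_part a < dual_part b"

definition less_eq_dual :: "'a dual \<Rightarrow> 'a dual \<Rightarrow> bool" where
  "a \<le> b \<longleftrightarrow> a < b \<or> a = (b :: 'a dual)"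

instance
  by standard (auto simp: less_dual_def less_eq_dual_def dual_eq_iff)

end

instantiation dual :: (conjugatable_ring) conjugatable_ring
begin

definition conjugate_dual :: "'a dual \<Rightarrow> 'a dual" where
  "conjugate a = Dual (conjugate (std_part a)) (conjugate (dual_part a))"

instance
  by standard
    (auto simp: conjugate_dual_def dual_ring_defs conjugate_dist_mul conjugate_dist_add
      conjugate_neg dual_eq_iff)

end

definition appreciable :: "'a::zero dual \<Rightarrow> bool" where
  "appreciable a \<longleftrightarrow> std_part a \<noteq> 0"

definition infinitesimal :: "'a::zero dual \<Rightarrow> bool" where
  "infinitesimal a \<longleftrightarrow> std_part a = 0"

definition complex_of_dual :: "real dual \<Rightarrow> complex dual" where
  "complex_of_dual a = Dual (complex_of_real (std_part a)) (complex_of_real (dual_part a))"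


section \<open>Dual complex matrices\<close>

abbreviation std_mat :: "'a dual mat \<Rightarrow> 'a mat" where
  "std_mat A \<equiv> map_mat std_part A"

abbreviation dual_mat :: "'a dual mat \<Rightarrow> 'a mat" where
  "dual_mat A \<equiv> map_mat dual_part A"

text \<open>The matrix \<open>B \<epsilon>\<close>.\<close>

definition eps_mat :: "'a::zero mat \<Rightarrow> 'a dual mat" where
  "eps_mat B = map_mat (Dual 0) B"

abbreviation cmat :: "real dual mat \<Rightarrow> complex dual mat" where
  "cmat S \<equiv> map_mat complex_of_dual S"

text \<open>The library's \<open>mat_adjoint\<close> is restricted to fields, which excludes dual numbers;
  the two agree on complex matrices.\<close>

definition ctranspose :: "'a::conjugatable_ring mat \<Rightarrow> 'a mat"  ("(_\<^sup>\<dagger>)" [1000] 999) where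
  "A\<^sup>\<dagger> = map_mat conjugate (transpose_mat A)"

lemma ctranspose_eq_mat_adjoint:
  fixes A :: "'a::conjugatable_field mat"
  shows "A\<^sup>\<dagger> = mat_adjoint A"
  by (rule eq_matI) (auto simp: ctranspose_def mat_adjoint_def mat_of_rows_def)

lemma ctranspose_parts:
  fixes A :: "'a::conjugatable_ring dual mat"
  shows "std_mat (A\<^sup>\<dagger>) = (std_mat A)\<^sup>\<dagger>" and "dual_mat (A\<^sup>\<dagger>) = (dual_mat A)\<^sup>\<dagger>"
  by (rule eq_matI; simp add: ctranspose_def conjugate_dual_def)+

definition unitary_mat :: "nat \<Rightarrow> complex dual mat \<Rightarrow> bool" where
  "unitary_mat n U \<longleftrightarrow>
     U \<in> carrier_mat n n \<and> U\<^sup>\<dagger> * U = 1\<^sub>m n \<and> U * U\<^sup>\<dagger> = 1\<^sub>m n"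

definition hermitian_mat :: "complex dual mat \<Rightarrow> bool" where
  "hermitian_mat A \<longleftrightarrow> A\<^sup>\<dagger> = A"

definition idempotent_mat :: "complex dual mat \<Rightarrow> bool" where
  "idempotent_mat A \<longleftrightarrow> A * A = A"

definition normal_mat :: "complex dual mat \<Rightarrow> bool" where
  "normal_mat A \<longleftrightarrow> A * A\<^sup>\<dagger> = A\<^sup>\<dagger> * A"


section \<open>Singular value decomposition and essential part\<close>

definition appreciable_diag :: "nat \<Rightarrow> real dual mat \<Rightarrow> bool" where
  "appreciable_diag r S \<longleftrightarrow>
     S \<in> carrier_mat r r \<and> diagonal_mat S \<and>
     (\<forall>i<r. 0 < S $$ (i,i) \<and> appreciable (S $$ (i,i))) \<and>
     (\<forall>i j. i \<le> j \<longrightarrow> j < r \<longrightarrow> S $$ (j,j) \<le> S $$ (i,i))"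

text \<open>Here \<open>s\<close> is the number of nonzero infinitesimal singular values (\<open>t - r\<close> in the usual
  indexing).\<close>

definition infinitesimal_diag :: "nat \<Rightarrow> nat \<Rightarrow> real dual mat \<Rightarrow> bool" where
  "infinitesimal_diag p q S \<longleftrightarrow>
     S \<in> carrier_mat p q \<and> diagonal_mat S \<and>
     (\<exists>s \<le> min p q.
        (\<forall>i<s. 0 < S $$ (i,i) \<and> infinitesimal (S $$ (i,i))) \<and>
        (\<forall>i j. i \<le> j \<longrightarrow> j < s \<longrightarrow> S $$ (j,j) \<le> S $$ (i,i)) \<and>
        (\<forall>i. s \<le> i \<longrightarrow> i < min p q \<longrightarrow> S $$ (i,i) = 0))"

definition dual_svd ::
  "nat \<Rightarrow> nat \<Rightarrow> nat \<Rightarrow> complex dual mat \<Rightarrow>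
   complex dual mat \<Rightarrow> real dual mat \<Rightarrow> real dual mat \<Rightarrow> complex dual mat \<Rightarrow> bool" where
  "dual_svd m n r A U S1 S2 V \<longleftrightarrow>
     A \<in> carrier_mat m n \<and> r \<le> m \<and> r \<le> n \<and>
     unitary_mat m U \<and> unitary_mat n V \<and>
     appreciable_diag r S1 \<and> infinitesimal_diag (m - r) (n - r) S2 \<and>
     A = U * four_block_mat (cmat S1) (0\<^sub>m r (n - r)) (0\<^sub>m (m - r) r) (cmat S2) * V\<^sup>\<dagger>"

text \<open>The singular value decomposition exists and the matrix \<open>E\<close> below does not depend on its
  choice, so the definite description is well defined.\<close>

definition essential_part :: "complex dual mat \<Rightarrow> complex dual mat" where
  "essential_part A = (THE E. \<exists>m n r U S1 S2 V. dual_svd m n r A U S1 S2 V \<and>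
     E = U * four_block_mat (cmat S1) (0\<^sub>m r (n - r))
               (0\<^sub>m (m - r) r) (0\<^sub>m (m - r) (n - r)) * V\<^sup>\<dagger>)"


section \<open>Hartwig-Spindelboeck decomposition\<close>

definition hs_decomposition ::
  "nat \<Rightarrow> nat \<Rightarrow> complex dual mat \<Rightarrow>
   complex dual mat \<Rightarrow> real dual mat \<Rightarrow> real dual mat \<Rightarrow>
   complex dual mat \<Rightarrow> complex dual mat \<Rightarrow> complex dual mat \<Rightarrow> complex dual mat \<Rightarrow> bool" where
  "hs_decomposition n r A U S1 S2 K L M N \<longleftrightarrow>
     A \<in> carrier_mat n n \<and> r \<le> n \<and> unitary_mat n U \<and>
     appreciable_diag r S1 \<and> infinitesimal_diag (n - r) (n - r) S2 \<and>
     K \<in> carrier_mat r r \<and> L \<in> carrier_mat r (n - r) \<and>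
     M \<in> carrier_mat (n - r) r \<and> N \<in> carrier_mat (n - r) (n - r) \<and>
     K * K\<^sup>\<dagger> + L * L\<^sup>\<dagger> = 1\<^sub>m r \<and>
     K * M\<^sup>\<dagger> + L * N\<^sup>\<dagger> = 0\<^sub>m r (n - r) \<and>
     A = U * four_block_mat (cmat S1 * K) (cmat S1 * L)
               (cmat S2 * M) (cmat S2 * N) * U\<^sup>\<dagger> \<and>
     essential_part A = U * four_block_mat (cmat S1 * K) (cmat S1 * L)
               (0\<^sub>m (n - r) r) (0\<^sub>m (n - r) (n - r)) * U\<^sup>\<dagger>"


section \<open>New dual Moore-Penrose inverse\<close>

definition is_ndmpi :: "complex dual mat \<Rightarrow> complex dual mat \<Rightarrow> bool" where
  "is_ndmpi A X \<longleftrightarrow>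
     X \<in> carrier_mat (dim_col A) (dim_row A) \<and>
     A * X * A = essential_part A \<and> X * A * X = X \<and>
     (A * X)\<^sup>\<dagger> = A * X \<and> (X * A)\<^sup>\<dagger> = X * A"

definition ndmpi :: "complex dual mat \<Rightarrow> complex dual mat"  ("(_\<^sup>N)" [1000] 999) where
  "A\<^sup>N = (THE X. is_ndmpi A X)"

definition new_dual_EP :: "complex dual mat \<Rightarrow> bool" where
  "new_dual_EP A \<longleftrightarrow> A * A\<^sup>N = A\<^sup>N * A"

end

theory Submission
  imports Defs
begin

text \<open>In the basis \<open>U\<close> the matrix \<open>A\<close> has block rows \<open>\<Sigma>\<^sub>1 Q\<close> and \<open>\<Sigma>\<^sub>2 P\<close>, where \<open>Q = [K L]\<close> and
  \<open>P = [M N]\<close> satisfy \<open>Q Q\<^sup>* = I\<close> and \<open>Q P\<^sup>* = O\<close>. These two relations alone show that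
  \<open>[Q\<^sup>* \<Sigma>\<^sub>1\<^sup>-\<^sup>1, O]\<close> satisfies the defining equations of the NDMPI, which have at most one solution.
  Each condition on \<open>A\<close> then becomes a block identity; multiplying it by \<open>Q\<close> from the left removes the
  factor \<open>Q\<^sup>*\<close>, and every product of the form \<open>\<Sigma>\<^sub>2 X \<Sigma>\<^sub>2\<close> vanishes because \<open>\<Sigma>\<^sub>2\<close> is infinitesimal.\<close>

section \<open>Matrices over commutative rings with conjugation\<close>

text \<open>Conformability is expressed by dimensions, which the simplifier can compute, so that
  long products normalise to the right without carrier side conditions.\<close>

lemma mult_mat_assoc:
  fixes A :: "'a::semiring_0 mat"
  assumes "dim_col A = dim_row B" "dim_col B = dim_row C"
  shows "A * B * C = A * (B * C)"
  using assms by (metis assoc_mult_mat carrier_matI)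

lemma mult_mat_add_left:
  fixes A :: "'a::semiring_0 mat"
  assumes "dim_row A = dim_row B" "dim_col A = dim_col B" "dim_col B = dim_row C"
  shows "(A + B) * C = A * C + B * C"
  using assms by (metis add_mult_distrib_mat carrier_matI)

lemma mult_mat_add_right:
  fixes A :: "'a::semiring_0 mat"
  assumes "dim_row B = dim_row C" "dim_col B = dim_col C" "dim_col A = dim_row B"
  shows "A * (B + C) = A * B + A * C"
  using assms by (metis mult_add_distrib_mat carrier_matI)

text \<open>In products nested to the right \<open>A * B\<close> is no subterm any more; this form
  still cancels the pair in front of \<open>X\<close>.\<close>

lemma mult_mat_inverse_cancel:
  fixes A :: "'a::semiring_1 mat"
  assumes "A * B = 1\<^sub>m n" "dim_col A = dim_row B" "dim_col B = dim_row X" "dim_row X = n"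
  shows "A * (B * X) = X"
proof -
  have "A * (B * X) = A * B * X"
    using assms(2,3) by (simp only: mult_mat_assoc)
  also have "\<dots> = X"
    unfolding assms(1) by (rule left_mult_one_mat[of _ n "dim_col X"]) (rule carrier_matI[OF assms(4) refl])
  finally show ?thesis .
qed

lemmas mat_arith = mult_mat_assoc mult_mat_add_left mult_mat_add_right

section \<open>Conjugate transpose and block matrices\<close>

lemma ctranspose_dims [simp]: "dim_row (A\<^sup>\<dagger>) = dim_col A" "dim_col (A\<^sup>\<dagger>) = dim_row A"
  by (auto simp: ctranspose_def)

lemma ctranspose_carrier [simp]: "A \<in> carrier_mat m n \<Longrightarrow> A\<^sup>\<dagger> \<in> carrier_mat n m"
  by (intro carrier_matI) (simp_all only: ctranspose_dims carrier_matD)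

lemma ctranspose_index [simp]:
  "i < dim_col A \<Longrightarrow> j < dim_row A \<Longrightarrow> A\<^sup>\<dagger> $$ (i, j) = conjugate (A $$ (j, i))"
  by (auto simp: ctranspose_def)

lemma ctranspose_ctranspose [simp]: "(A\<^sup>\<dagger>)\<^sup>\<dagger> = A"
  by (rule eq_matI) auto

lemma ctranspose_inject [simp]: "A\<^sup>\<dagger> = B\<^sup>\<dagger> \<longleftrightarrow> A = B"
  by (metis ctranspose_ctranspose)

lemma ctranspose_zero [simp]: "(0\<^sub>m m n)\<^sup>\<dagger> = 0\<^sub>m n m"
  by (rule eq_matI) auto

lemma ctranspose_one [simp]: "(1\<^sub>m n :: complex dual mat)\<^sup>\<dagger> = 1\<^sub>m n"
  by (rule eq_matI) (auto simp: conjugate_dual_def dual_ring_defs)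

lemma ctranspose_add:
  assumes "dim_row A = dim_row B" "dim_col A = dim_col B"
  shows "(A + B)\<^sup>\<dagger> = A\<^sup>\<dagger> + B\<^sup>\<dagger>"
  using assms by (intro eq_matI) (auto simp: conjugate_dist_add)

lemma ctranspose_mult:
  fixes A :: "'a::{conjugatable_ring, comm_ring} mat"
  assumes "dim_col A = dim_row B"
  shows "(A * B)\<^sup>\<dagger> = B\<^sup>\<dagger> * A\<^sup>\<dagger>"
  using assms
  by (intro eq_matI)
    (auto simp: scalar_prod_def sum_conjugate conjugate_dist_mul mult.commute intro!: sum.cong)

lemma ctranspose_four_block:
  assumes "A \<in> carrier_mat n1 m1" "B \<in> carrier_mat n1 m2"
    and "C \<in> carrier_mat n2 m1" "D \<in> carrier_mat n2 m2"
  shows "(four_block_mat A B C D)\<^sup>\<dagger> = four_block_mat (A\<^sup>\<dagger>) (C\<^sup>\<dagger>) (B\<^sup>\<dagger>) (D\<^sup>\<dagger>)"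
  using assms by (intro eq_matI) auto

text \<open>Each block reappears in the whole matrix with rows shifted by \<open>n1\<close> or
  columns shifted by \<open>m1\<close>, so comparing entries separates the blocks.\<close>

lemma four_block_mat_inject:
  assumes "A \<in> carrier_mat n1 m1" "B \<in> carrier_mat n1 m2"
    and "C \<in> carrier_mat n2 m1" "D \<in> carrier_mat n2 m2"
    and "A' \<in> carrier_mat n1 m1" "B' \<in> carrier_mat n1 m2"
    and "C' \<in> carrier_mat n2 m1" "D' \<in> carrier_mat n2 m2"
  shows "four_block_mat A B C D = four_block_mat A' B' C' D' \<longleftrightarrow>
    A = A' \<and> B = B' \<and> C = C' \<and> D = D'" (is "?l = ?r \<longleftrightarrow> ?c")
proof
  assume eq: "?l = ?r"
  have ix: "?l $$ (i, j) = ?r $$ (i, j)" for i j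
    by (simp add: eq)
  have "A = A'"
  proof (rule eq_matI)
    fix i j assume "i < dim_row A'" "j < dim_col A'"
    then show "A $$ (i, j) = A' $$ (i, j)" using assms ix[of i j] by auto
  qed (use assms in auto)
  moreover have "B = B'"
  proof (rule eq_matI)
    fix i j assume "i < dim_row B'" "j < dim_col B'"
    then show "B $$ (i, j) = B' $$ (i, j)" using assms ix[of i "j + m1"] by auto
  qed (use assms in auto)
  moreover have "C = C'"
  proof (rule eq_matI)
    fix i j assume "i < dim_row C'" "j < dim_col C'"
    then show "C $$ (i, j) = C' $$ (i, j)" using assms ix[of "i + n1" j] by auto
  qed (use assms in auto)
  moreover have "D = D'"
  proof (rule eq_matI)
    fix i j assume "i < dim_row D'" "j < dim_col D'"
    then show "D $$ (i, j) = D' $$ (i, j)" using assms ix[of "i + n1" "j + m1"] by auto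
  qed (use assms in auto)
  ultimately show ?c by blast
qed auto

text \<open>Dual numbers form no field, so the adjugate is used: multiplying
  \<open>adj_mat A * A\<close> by \<open>B\<close> from the right gives
  \<open>adj_mat A = det A \<cdot>\<^sub>m B\<close>. Hence \<open>B * A\<close> and the identity
  agree after scaling by \<open>det A\<close>, a unit with inverse \<open>det B\<close>.\<close>

lemma mat_left_inverse_if_right_inverse:
  fixes A :: "'a::comm_ring_1 mat"
  assumes A: "A \<in> carrier_mat n n" and B: "B \<in> carrier_mat n n" and AB: "A * B = 1\<^sub>m n"
  shows "B * A = 1\<^sub>m n"
proof -
  have det: "det B * det A = 1"
    using det_mult[OF A B] AB by (simp add: mult.commute)
  have adj: "adj_mat A \<in> carrier_mat n n" "adj_mat A * A = det A \<cdot>\<^sub>m 1\<^sub>m n"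
    using adj_mat[OF A] by auto
  have "adj_mat A = adj_mat A * A * B"
    using A B AB adj(1) by simp
  also have "\<dots> = det A \<cdot>\<^sub>m B"
    using B by (simp add: adj(2) mult_smult_assoc_mat[of _ n n])
  finally have "adj_mat A * A = det A \<cdot>\<^sub>m (B * A)"
    using A B by (simp add: mult_smult_assoc_mat[of _ n n])
  moreover have one_smult: "1 \<cdot>\<^sub>m Z = Z" and smult_smult: "a \<cdot>\<^sub>m (b \<cdot>\<^sub>m Z) = (a * b) \<cdot>\<^sub>m Z"
    for Z :: "'a mat" and a b
    by (auto intro!: eq_matI simp: mult.assoc)
  ultimately have "det B \<cdot>\<^sub>m (det A \<cdot>\<^sub>m (B * A)) = det B \<cdot>\<^sub>m (det A \<cdot>\<^sub>m 1\<^sub>m n)"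
    using adj(2) by simp
  then show ?thesis
    by (simp only: smult_smult det one_smult)
qed

section \<open>Conjugation by a unitary matrix\<close>

lemma unitary_conj_mult:
  assumes "unitary_mat n U" "X \<in> carrier_mat n n" "Y \<in> carrier_mat n n"
  shows "(U * X * U\<^sup>\<dagger>) * (U * Y * U\<^sup>\<dagger>) = U * (X * Y) * U\<^sup>\<dagger>"
  using assms
  by (auto simp: unitary_mat_def mult_mat_assoc mult_mat_inverse_cancel[where n = n and A = "U\<^sup>\<dagger>"])

lemma unitary_conj_ctranspose:
  assumes "unitary_mat n U" "X \<in> carrier_mat n n"
  shows "(U * X * U\<^sup>\<dagger>)\<^sup>\<dagger> = U * X\<^sup>\<dagger> * U\<^sup>\<dagger>"
  using assms by (auto simp: unitary_mat_def mult_mat_assoc ctranspose_mult)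

lemma unitary_conj_inject:
  assumes "unitary_mat n U" "X \<in> carrier_mat n n" "Y \<in> carrier_mat n n"
  shows "U * X * U\<^sup>\<dagger> = U * Y * U\<^sup>\<dagger> \<longleftrightarrow> X = Y"
proof
  have cancel: "U\<^sup>\<dagger> * (U * Z * U\<^sup>\<dagger>) * U = Z" if "Z \<in> carrier_mat n n" for Z
    using assms that
    by (auto simp: unitary_mat_def mult_mat_assoc mult_mat_inverse_cancel[where n = n and A = "U\<^sup>\<dagger>"])
  assume "U * X * U\<^sup>\<dagger> = U * Y * U\<^sup>\<dagger>"
  then show "X = Y"
    by (metis cancel assms(2,3))
qed auto


section \<open>Dual matrices\<close>

lemma std_part_sum: "std_part (sum f I) = (\<Sum>i\<in>I. std_part (f i))"
  by (induction I rule: infinite_finite_induct) (auto simp: dual_ring_defs)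

lemma dual_part_sum: "dual_part (sum f I) = (\<Sum>i\<in>I. dual_part (f i))"
  by (induction I rule: infinite_finite_induct) (auto simp: dual_ring_defs)

lemma std_mat_mult:
  fixes A B :: "'a::ring dual mat"
  assumes "dim_col A = dim_row B"
  shows "std_mat (A * B) = std_mat A * std_mat B"
  using assms
  by (intro eq_matI) (auto simp: scalar_prod_def std_part_sum times_dual_def intro!: sum.cong)

lemma std_mat_one [simp]: "std_mat (1\<^sub>m n :: 'a::zero_neq_one dual mat) = 1\<^sub>m n"
  by (rule eq_matI) (auto simp: dual_ring_defs)

lemma eps_mat_dims [simp]: "dim_row (eps_mat E) = dim_row E" "dim_col (eps_mat E) = dim_col E"
  by (auto simp: eps_mat_def)

lemma eps_mat_inject [simp]: "eps_mat E = eps_mat F \<longleftrightarrow> E = F"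
  by (auto simp: eps_mat_def mat_eq_iff)

lemma eps_mat_zero [simp]: "eps_mat (0\<^sub>m m n) = 0\<^sub>m m n"
  by (rule eq_matI) (auto simp: eps_mat_def dual_ring_defs)

text \<open>As \<epsilon>^2 = 0, only the standard part of the other factor survives.\<close>

lemma eps_mat_mult_right:
  fixes A :: "'a::ring dual mat"
  assumes "dim_col E = dim_row A"
  shows "eps_mat E * A = eps_mat (E * std_mat A)"
  using assms
  by (intro eq_matI)
    (auto simp: eps_mat_def scalar_prod_def std_part_sum dual_part_sum dual_eq_iff times_dual_def
      intro!: sum.cong)

lemma eps_mat_mult_left:
  fixes A :: "'a::ring dual mat"
  assumes "dim_col A = dim_row E"
  shows "A * eps_mat E = eps_mat (std_mat A * E)"
  using assms
  by (intro eq_matI)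
    (auto simp: eps_mat_def scalar_prod_def std_part_sum dual_part_sum dual_eq_iff times_dual_def
      intro!: sum.cong)

lemma std_mat_eps_mat [simp]: "std_mat (eps_mat E) = 0\<^sub>m (dim_row E) (dim_col E)"
  by (rule eq_matI) (auto simp: eps_mat_def)

lemma eps_mat_dual_mat:
  assumes "\<And>i j. i < dim_row A \<Longrightarrow> j < dim_col A \<Longrightarrow> std_part (A $$ (i, j)) = 0"
  shows "eps_mat (dual_mat A) = A"
  using assms by (intro eq_matI) (auto simp: eps_mat_def dual_eq_iff)

section \<open>Inverses and diagonal factors\<close>

lemma ctranspose_cmat_diagonal:
  assumes "diagonal_mat S" "S \<in> carrier_mat n n"
  shows "(cmat S)\<^sup>\<dagger> = cmat S"
proof (rule eq_matI)
  fix i j assume "i < dim_row (cmat S)" "j < dim_col (cmat S)"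
  then show "(cmat S)\<^sup>\<dagger> $$ (i, j) = cmat S $$ (i, j)"
    using assms
    by (cases "i = j")
      (auto simp: diagonal_mat_def conjugate_dual_def complex_of_dual_def dual_ring_defs)
qed (use assms in auto)

text \<open>The result \<open>None\<close> would mean that \<open>A\<close> is not a unit of the
  matrix ring, yet \<open>B\<close> shows that it is one; any \<open>Some C\<close> agrees with
  \<open>B\<close> because two-sided inverses are unique.\<close>

lemma mat_inverse_eqI:
  fixes A :: "'a::field mat"
  assumes A: "A \<in> carrier_mat n n" and B: "B \<in> carrier_mat n n"
    and AB: "A * B = 1\<^sub>m n" and BA: "B * A = 1\<^sub>m n"
  shows "mat_inverse A = Some B"
proof (cases "mat_inverse A")
  case None
  have "A \<in> Units (ring_mat TYPE('a) n undefined)"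
    using assms by (auto simp: Units_def ring_mat_def)
  then show ?thesis
    using mat_inverse(1)[OF A None, of undefined] by blast
next
  case (Some C)
  from mat_inverse(2)[OF A Some] have C: "A * C = 1\<^sub>m n" "C \<in> carrier_mat n n" by auto
  have "B = B * (A * C)" using B C by simp
  also have "\<dots> = B * A * C" by (rule assoc_mult_mat[OF B A C(2), symmetric])
  also have "\<dots> = C" using C(2) by (simp add: BA)
  finally show ?thesis using Some by simp
qed

text \<open>In the lexicographic order, a positive dual number with nonzero standard part has a
  positive standard part. The form \<open>mat_diag\<close> reduces later products to
  entries.\<close>

lemma appreciable_diag_mat_diag:
  assumes "appreciable_diag r S"
  obtains d where "\<And>i. i < r \<Longrightarrow> 0 < std_part (d i)"
    and "cmat S = mat_diag r (\<lambda>i. complex_of_dual (d i))"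
    and "S = mat_diag r d"
proof
  show "0 < std_part (S $$ (i, i))" if "i < r" for i
    using assms that by (force simp: appreciable_diag_def appreciable_def less_dual_def zero_dual_def)
  show "S = mat_diag r (\<lambda>i. S $$ (i, i))"
    using assms by (intro eq_matI) (auto simp: appreciable_diag_def mat_diag_def diagonal_mat_def)
  show "cmat S = mat_diag r (\<lambda>i. complex_of_dual (S $$ (i, i)))"
    using assms
    by (intro eq_matI)
      (auto simp: appreciable_diag_def mat_diag_def diagonal_mat_def complex_of_dual_def dual_ring_defs)
qed

lemma appreciable_diag_inverse:
  assumes "appreciable_diag r S"
  obtains Si where "Si \<in> carrier_mat r r" "cmat S * Si = 1\<^sub>m r" "Si * cmat S = 1\<^sub>m r"
proof -
  obtain d where d: "\<And>i. i < r \<Longrightarrow> 0 < std_part (d i)"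
      "cmat S = mat_diag r (\<lambda>i. complex_of_dual (d i))"
    using appreciable_diag_mat_diag[OF assms] by metis
  \<comment> \<open>The inverse of a + b \<epsilon> is 1/a - (b/a^2) \<epsilon>.\<close>
  define e where "e i = complex_of_dual (Dual (1 / std_part (d i)) (- dual_part (d i) / (std_part (d i))\<^sup>2))" for i
  have e: "complex_of_dual (d i) * e i = 1" "e i * complex_of_dual (d i) = 1" if "i < r" for i
    using d(1)[OF that]
    by (auto simp: e_def complex_of_dual_def dual_ring_defs power2_eq_square field_simps
        simp flip: of_real_add of_real_mult of_real_divide)
  have "cmat S * mat_diag r e = 1\<^sub>m r" "mat_diag r e * cmat S = 1\<^sub>m r"
    unfolding d(2) mat_diag_diag by (auto simp: mat_diag_def e intro!: eq_matI)
  then show ?thesis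
    using that[of "mat_diag r e"] by auto
qed

text \<open>The sum of two positive appreciable dual numbers is a unit, so it cancels in
  \<open>(a\<^sub>i\<^sup>2 - a\<^sub>j\<^sup>2) x = (a\<^sub>i + a\<^sub>j) (a\<^sub>i - a\<^sub>j) x\<close>.\<close>

lemma appreciable_diag_square_commute:
  assumes "appreciable_diag r S" and X: "X \<in> carrier_mat r r"
  shows "cmat S * cmat S * X = X * (cmat S * cmat S) \<longleftrightarrow> cmat S * X = X * cmat S"
proof
  obtain d where d: "\<And>i. i < r \<Longrightarrow> 0 < std_part (d i)"
      "cmat S = mat_diag r (\<lambda>i. complex_of_dual (d i))"
    using appreciable_diag_mat_diag[OF assms(1)] by metis
  assume eq: "cmat S * cmat S * X = X * (cmat S * cmat S)"
  show "cmat S * X = X * cmat S"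
  proof (rule eq_matI)
    fix i j assume "i < dim_row (X * cmat S)" "j < dim_col (X * cmat S)"
    then have ij: "i < r" "j < r" using X assms(1) by (auto simp: appreciable_diag_def)
    define a b x where "a = complex_of_dual (d i)" and "b = complex_of_dual (d j)"
      and "x = X $$ (i, j)"
    have "(cmat S * cmat S * X) $$ (i, j) = (X * (cmat S * cmat S)) $$ (i, j)"
      by (simp add: eq)
    then have "a * a * x = x * (b * b)"
      using ij X unfolding d(2) mat_diag_diag
      by (simp add: mat_diag_mult_left[OF X] mat_diag_mult_right[OF X] a_def b_def x_def)
    then have "(a + b) * (a * x - x * b) = 0"
      by (simp add: algebra_simps)
    moreover have "std_part (a + b) \<noteq> 0"
    proof -
      have "std_part (a + b) = complex_of_real (std_part (d i) + std_part (d j))"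
        by (simp add: a_def b_def complex_of_dual_def plus_dual_def)
      moreover have "std_part (d i) + std_part (d j) \<noteq> 0"
        using d(1)[OF ij(1)] d(1)[OF ij(2)] by simp
      ultimately show ?thesis by (simp only: of_real_eq_0_iff not_False_eq_True)
    qed
    moreover have "z = 0" if "y * z = 0" "std_part y \<noteq> 0" for y z :: "complex dual"
      using that by (auto simp: zero_dual_def times_dual_def dual_eq_iff)
    ultimately have "a * x - x * b = 0"
      by blast
    then show "(cmat S * X) $$ (i, j) = (X * cmat S) $$ (i, j)"
      using ij X unfolding d(2)
      by (simp add: mat_diag_mult_left[OF X] mat_diag_mult_right[OF X] a_def b_def x_def)
  qed (use assms in \<open>auto simp: appreciable_diag_def\<close>)
next
  assume "cmat S * X = X * cmat S"
  then show "cmat S * cmat S * X = X * (cmat S * cmat S)"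
    using assms by (smt (verit) appreciable_diag_def carrier_matD map_carrier_mat mult_mat_assoc)
qed

text \<open>For an entry a + b \<epsilon> the equation says a^2 = 1 and 2ab = 0; since a > 0, this
  forces a = 1 and b = 0.\<close>

lemma appreciable_diag_square_eq_one:
  assumes "appreciable_diag r S"
  shows "cmat S * cmat S = 1\<^sub>m r \<longleftrightarrow> S = 1\<^sub>m r"
proof
  obtain d where d: "\<And>i. i < r \<Longrightarrow> 0 < std_part (d i)"
      "cmat S = mat_diag r (\<lambda>i. complex_of_dual (d i))" "S = mat_diag r d"
    using appreciable_diag_mat_diag[OF assms] by metis
  assume eq: "cmat S * cmat S = 1\<^sub>m r"
  have "d i = 1" if "i < r" for i
  proof -
    have "(cmat S * cmat S) $$ (i, i) = (1\<^sub>m r :: complex dual mat) $$ (i, i)"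
      by (simp add: eq)
    then have "complex_of_dual (d i) * complex_of_dual (d i) = 1"
      using that unfolding d(2) mat_diag_diag by (simp add: mat_diag_def)
    then have "std_part (d i) * std_part (d i) = 1" "std_part (d i) * dual_part (d i) = 0"
      by (auto simp: complex_of_dual_def dual_ring_defs mult.commute
          simp flip: of_real_mult of_real_add)
    then show ?thesis
      using d(1)[OF that] by (auto simp: dual_eq_iff one_dual_def square_eq_1_iff)
  qed
  then show "S = 1\<^sub>m r"
    unfolding d(3) by (auto simp: mat_diag_def intro!: eq_matI)
next
  assume S: "S = 1\<^sub>m r"
  have "cmat S = 1\<^sub>m r"
    unfolding S by (rule eq_matI) (auto simp: complex_of_dual_def dual_ring_defs)
  then show "cmat S * cmat S = 1\<^sub>m r" by simp
qed

text \<open>An entry is either off the diagonal and zero, or one of the leading infinitesimal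
  values, or one of the trailing zeros; its standard part vanishes in each case.\<close>

lemma infinitesimal_diag_eps_mat:
  assumes "infinitesimal_diag p q S"
  shows "eps_mat (dual_mat (cmat S)) = cmat S"
proof (rule eps_mat_dual_mat)
  fix i j assume "i < dim_row (cmat S)" "j < dim_col (cmat S)"
  moreover from this have "std_part (S $$ (i, j)) = 0"
  proof (cases "i = j")
    case True
    then have "i < min p q"
      using assms \<open>i < dim_row (cmat S)\<close> \<open>j < dim_col (cmat S)\<close>
      by (auto simp: infinitesimal_diag_def)
    with True show ?thesis
      using assms
      by (metis dual.sel(1) infinitesimal_def infinitesimal_diag_def not_le zero_dual_def)
  next
    case False
    with calculation show ?thesis
      using assms by (auto simp: infinitesimal_diag_def diagonal_mat_def zero_dual_def)
  qed
  ultimately show "std_part (cmat S $$ (i, j)) = 0"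
    by (simp add: complex_of_dual_def)
qed


section \<open>Uniqueness of the new dual Moore-Penrose inverse\<close>

text \<open>Penrose's argument, with the common value of \<open>A * X * A\<close> and
  \<open>A * Y * A\<close> being the essential part instead of \<open>A\<close>. The products
  \<open>A * X\<close> and \<open>A * Y\<close> are Hermitian idempotents that act alike on anything
  of the form \<open>A * Z\<close>; hence each absorbs the other, and taking adjoints makes them
  equal. The same holds for \<open>X * A\<close> and \<open>Y * A\<close>, so
  \<open>X = X * A * X = X * A * Y = Y * A * Y = Y\<close>.\<close>

lemma is_ndmpi_unique:
  assumes X: "is_ndmpi A X" and Y: "is_ndmpi A Y"
  shows "X = Y"
proof -
  have [simp]: "dim_row X = dim_col A" "dim_col X = dim_row A"
    "dim_row Y = dim_col A" "dim_col Y = dim_row A"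
    using X Y by (auto simp: is_ndmpi_def)
  have AXA: "A * X * A = A * Y * A"
    using X Y by (simp add: is_ndmpi_def)
  have ax: "A * X * (A * Z) = A * Y * (A * Z)" "Z * A * (X * A) = Z * A * (Y * A)"
    if "dim_row Z = dim_col A" "dim_col Z = dim_row A" for Z
  proof -
    have "A * X * (A * Z) = (A * X * A) * Z"
      using that by (simp add: mult_mat_assoc)
    also have "\<dots> = A * Y * (A * Z)"
      unfolding AXA using that by (simp add: mult_mat_assoc)
    finally show "A * X * (A * Z) = A * Y * (A * Z)" .
    have "Z * A * (X * A) = Z * (A * X * A)"
      using that by (simp add: mult_mat_assoc)
    also have "\<dots> = Z * A * (Y * A)"
      unfolding AXA using that by (simp add: mult_mat_assoc)
    finally show "Z * A * (X * A) = Z * A * (Y * A)" .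
  qed
  \<comment> \<open>Idempotence follows from \<open>Z * A * Z = Z\<close> alone, by multiplying it
    by \<open>A\<close> on either side.\<close>
  have XX: "A * X * (A * X) = A * X" "X * A * (X * A) = X * A"
    and YY: "A * Y * (A * Y) = A * Y" "Y * A * (Y * A) = Y * A"
  proof -
    have "A * Z * (A * Z) = A * Z \<and> Z * A * (Z * A) = Z * A" if "is_ndmpi A Z" for Z
    proof -
      have ZAZ: "Z * A * Z = Z" using that by (simp add: is_ndmpi_def)
      have "dim_row Z = dim_col A" "dim_col Z = dim_row A"
        using that by (auto simp: is_ndmpi_def)
      then have "A * Z * (A * Z) = A * (Z * A * Z)" "Z * A * (Z * A) = Z * A * Z * A"
        by (simp_all add: mult_mat_assoc)
      with ZAZ show ?thesis by simp
    qed
    with X Y show "A * X * (A * X) = A * X" "X * A * (X * A) = X * A"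
      "A * Y * (A * Y) = A * Y" "Y * A * (Y * A) = Y * A" by blast+
  qed
  have "A * Y = (A * X * (A * Y))\<^sup>\<dagger>"
    using Y by (simp add: ax YY is_ndmpi_def)
  also have "\<dots> = A * Y * (A * X)"
    using X Y by (simp add: ctranspose_mult is_ndmpi_def)
  also have "\<dots> = A * X"
    using ax(1)[of X] XX by simp
  finally have AY: "A * Y = A * X" .
  have "Y * A = (Y * A * (X * A))\<^sup>\<dagger>"
    using Y by (simp add: ax YY is_ndmpi_def)
  also have "\<dots> = X * A * (Y * A)"
    using X Y by (simp add: ctranspose_mult is_ndmpi_def)
  also have "\<dots> = X * A"
    using ax(2)[of X] XX by simp
  finally have YA: "Y * A = X * A" .
  have "X = X * A * Y"
    using X AY by (simp add: is_ndmpi_def mult_mat_assoc)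
  also have "\<dots> = Y"
    using Y by (simp add: is_ndmpi_def flip: YA)
  finally show ?thesis .
qed

lemma ndmpi_eqI: "is_ndmpi A X \<Longrightarrow> A\<^sup>N = X"
  unfolding ndmpi_def by (rule the_equality) (auto intro: is_ndmpi_unique)


section \<open>The block form\<close>

text \<open>\<open>T\<close> plays the role of the infinitesimal \<open>\<Sigma>\<^sub>2\<close> and \<open>Si\<close> that of the inverse of \<open>\<Sigma>\<^sub>1\<close>; the
  matrices \<open>B\<close>, \<open>E\<close> and \<open>Y\<close> are those of \<open>A\<close>, its essential part and its NDMPI in the basis \<open>U\<close>.\<close>

locale hs_blocks =
  fixes r p :: nat and S Si T K L M N :: "complex dual mat"
  assumes carr: "S \<in> carrier_mat r r" "Si \<in> carrier_mat r r" "T \<in> carrier_mat p p"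
      "K \<in> carrier_mat r r" "L \<in> carrier_mat r p" "M \<in> carrier_mat p r" "N \<in> carrier_mat p p"
    and S_herm [simp]: "S\<^sup>\<dagger> = S" and T_herm [simp]: "T\<^sup>\<dagger> = T"
    and S_Si [simp]: "S * Si = 1\<^sub>m r" and Si_S [simp]: "Si * S = 1\<^sub>m r"
    and T_inf: "T = eps_mat (dual_mat T)"
    and KKLL: "K * K\<^sup>\<dagger> + L * L\<^sup>\<dagger> = 1\<^sub>m r"
    and KMLN: "K * M\<^sup>\<dagger> + L * N\<^sup>\<dagger> = 0\<^sub>m r p"
begin

definition "B = four_block_mat (S * K) (S * L) (T * M) (T * N)"

definition "E = four_block_mat (S * K) (S * L) (0\<^sub>m p r) (0\<^sub>m p p)"

definition "Y = four_block_mat (K\<^sup>\<dagger> * Si) (0\<^sub>m r p) (L\<^sup>\<dagger> * Si) (0\<^sub>m p p)"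

lemma dims [simp]:
  "dim_row S = r" "dim_col S = r" "dim_row Si = r" "dim_col Si = r" "dim_row T = p" "dim_col T = p"
  "dim_row K = r" "dim_col K = r" "dim_row L = r" "dim_col L = p"
  "dim_row M = p" "dim_col M = r" "dim_row N = p" "dim_col N = p"
  using carr by auto

lemma carrier_iff: "X \<in> carrier_mat a b \<longleftrightarrow> dim_row X = a \<and> dim_col X = b"
  by auto

text \<open>\<open>carrier_iff\<close> loops with the conditional simplification rules \<open>carrier_matD\<close>.\<close>

context
  notes carrier_matD [simp del] and assoc_mult_mat [simp del] and carrier_iff [simp]
begin

section \<open>Cancellation rules from the relations between Q and P\<close>

lemma MKNL: "M * K\<^sup>\<dagger> + N * L\<^sup>\<dagger> = 0\<^sub>m p r"
  using arg_cong[OF KMLN, of ctranspose] by (simp add: ctranspose_mult ctranspose_add)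

text \<open>This and the next two rules carry a trailing factor \<open>X\<close>, so that the
  relations apply inside products nested to the right.\<close>

lemma KKLL_mult: "dim_row X = r \<Longrightarrow> K * (K\<^sup>\<dagger> * X) + L * (L\<^sup>\<dagger> * X) = X"
  using arg_cong[OF KKLL, of "\<lambda>Z. Z * X"] left_mult_one_mat[of X r "dim_col X"]
  by (simp add: mat_arith)

lemma KMLN_mult: "dim_row X = p \<Longrightarrow> K * (M\<^sup>\<dagger> * X) + L * (N\<^sup>\<dagger> * X) = 0\<^sub>m r (dim_col X)"
  using arg_cong[OF KMLN, of "\<lambda>Z. Z * X"] left_mult_zero_mat[of X p "dim_col X" r]
  by (simp add: mat_arith)

lemma MKNL_mult: "dim_row X = r \<Longrightarrow> M * (K\<^sup>\<dagger> * X) + N * (L\<^sup>\<dagger> * X) = 0\<^sub>m p (dim_col X)"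
  using arg_cong[OF MKNL, of "\<lambda>Z. Z * X"] left_mult_zero_mat[of X r "dim_col X" p]
  by (simp add: mat_arith)

text \<open>The hypotheses are the two block rows of an equation with the adjoint of Q in front; Q
  is a left inverse of that adjoint.\<close>

lemma KL_cancel:
  assumes "K\<^sup>\<dagger> * X = K\<^sup>\<dagger> * Z" "L\<^sup>\<dagger> * X = L\<^sup>\<dagger> * Z" "dim_row X = r" "dim_row Z = r"
  shows "X = Z"
  by (metis assms KKLL_mult)

lemma S_Si_mult [simp]: "dim_row X = r \<Longrightarrow> S * (Si * X) = X" "dim_row X = r \<Longrightarrow> Si * (S * X) = X"
  by (simp_all add: mult_mat_inverse_cancel[where n = r])

lemma S_cancel:
  assumes "S * X = S * Z" "dim_row X = r" "dim_row Z = r"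
  shows "X = Z"
  by (metis assms S_Si_mult(2))

lemma Si_cancel:
  assumes "Si * X = Si * Z" "dim_row X = r" "dim_row Z = r"
  shows "X = Z"
  by (metis assms S_Si_mult(1))

lemma one_mult [simp]: "dim_row X = n \<Longrightarrow> 1\<^sub>m n * X = (X :: complex dual mat)"
    and mult_one [simp]: "dim_col X = n \<Longrightarrow> X * 1\<^sub>m n = (X :: complex dual mat)"
    and zero_mult [simp]: "dim_row X = n \<Longrightarrow> 0\<^sub>m m n * X = (0\<^sub>m m (dim_col X) :: complex dual mat)"
    and mult_zero [simp]: "dim_col X = n \<Longrightarrow> X * 0\<^sub>m n m = (0\<^sub>m (dim_row X) m :: complex dual mat)"
    and zero_add [simp]: "dim_row X = n \<Longrightarrow> dim_col X = m \<Longrightarrow> 0\<^sub>m n m + X = (X :: complex dual mat)"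
  for X n m
  by (auto intro!: left_mult_one_mat right_mult_one_mat left_mult_zero_mat right_mult_zero_mat
      left_add_zero_mat)

lemma T_mult_T [simp]: "T * T = 0\<^sub>m p p"
  by (subst (1 2) T_inf) (simp add: eps_mat_mult_right)

lemma T_mult_mult_T:
  assumes "dim_row X = p" "dim_col X = p"
  shows "T * (X * T) = 0\<^sub>m p p"
proof -
  have "T * (X * T) = eps_mat (dual_mat T) * (X * eps_mat (dual_mat T))"
    using T_inf by simp
  also have "\<dots> = 0\<^sub>m p p"
    using assms by (simp add: eps_mat_mult_right eps_mat_mult_left)
  finally show ?thesis .
qed

text \<open>A product with one infinitesimal factor is \<epsilon> times the product of that factor's
  dual part with the standard parts of the others. This turns dual conditions into conditions on
  complex matrices, here and in \<open>LTN_eq_0\<close>.\<close>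

lemma T_mult_eq_0: "dim_row X = p \<Longrightarrow> T * X = 0\<^sub>m p q \<longleftrightarrow> dual_mat T * std_mat X = 0\<^sub>m p q"
  by (subst T_inf) (simp add: eps_mat_mult_right flip: eps_mat_zero)

lemma LTN_eq_0: "L * T * N = 0\<^sub>m r p \<longleftrightarrow> std_mat L * dual_mat T * std_mat N = 0\<^sub>m r p"
proof -
  have "L * T * N = L * eps_mat (dual_mat T) * N"
    using T_inf by simp
  also have "\<dots> = eps_mat (std_mat L * dual_mat T * std_mat N)"
    by (simp add: eps_mat_mult_left eps_mat_mult_right)
  finally show ?thesis
    by (simp flip: eps_mat_zero)
qed

section \<open>Block products and the defining equations of the NDMPI\<close>

lemma mult_blocks:
  assumes "A1 \<in> carrier_mat r r" "B1 \<in> carrier_mat r p" "C1 \<in> carrier_mat p r" "D1 \<in> carrier_mat p p"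
    and "A2 \<in> carrier_mat r r" "B2 \<in> carrier_mat r p" "C2 \<in> carrier_mat p r" "D2 \<in> carrier_mat p p"
  shows "four_block_mat A1 B1 C1 D1 * four_block_mat A2 B2 C2 D2 =
    (four_block_mat (A1 * A2 + B1 * C2) (A1 * B2 + B1 * D2) (C1 * A2 + D1 * C2)
       (C1 * B2 + D1 * D2) :: complex dual mat)"
  using assms by (rule mult_four_block_mat)

lemmas blocks_inject = four_block_mat_inject[of _ r r _ p _ p]

lemma B_ctranspose: "B\<^sup>\<dagger> = four_block_mat (K\<^sup>\<dagger> * S) (M\<^sup>\<dagger> * T) (L\<^sup>\<dagger> * S) (N\<^sup>\<dagger> * T)"
  unfolding B_def
  by (subst ctranspose_four_block[of _ r r _ p _ p]) (simp_all add: ctranspose_mult)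

lemma B_carrier [simp]: "B \<in> carrier_mat (r + p) (r + p)"
  and E_carrier [simp]: "E \<in> carrier_mat (r + p) (r + p)"
  and Y_carrier [simp]: "Y \<in> carrier_mat (r + p) (r + p)"
  by (auto simp: B_def E_def Y_def)

text \<open>The nonzero blocks come from Q times its adjoint, where \<open>S\<close> meets its
  inverse, and from P times the adjoint of Q, which vanishes.\<close>

lemma B_mult_Y: "B * Y = four_block_mat (1\<^sub>m r) (0\<^sub>m r p) (0\<^sub>m p r) (0\<^sub>m p p)"
proof -
  have "S * (K * (K\<^sup>\<dagger> * Si)) + S * (L * (L\<^sup>\<dagger> * Si)) = 1\<^sub>m r"
    by (simp add: KKLL_mult flip: mult_mat_add_right)
  moreover have "T * (M * (K\<^sup>\<dagger> * Si)) + T * (N * (L\<^sup>\<dagger> * Si)) = 0\<^sub>m p r"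
    by (simp add: MKNL_mult flip: mult_mat_add_right)
  ultimately show ?thesis
    unfolding B_def Y_def by (simp add: mult_blocks mult_mat_assoc)
qed

lemma Y_mult_B: "Y * B = four_block_mat (K\<^sup>\<dagger> * K) (K\<^sup>\<dagger> * L) (L\<^sup>\<dagger> * K) (L\<^sup>\<dagger> * L)"
  unfolding B_def Y_def by (simp add: mult_blocks mult_mat_assoc)

text \<open>The projector \<open>B * Y\<close> keeps the upper block row of \<open>B\<close>, which
  is \<open>E\<close>, and keeps the left block column of \<open>Y\<close>, which is all of
  \<open>Y\<close>. The other projector, \<open>Y * B\<close>, is the adjoint of Q times Q and so
  visibly Hermitian.\<close>

lemma ndmpi_blocks:
  "B * Y * B = E" "Y * B * Y = Y" "(B * Y)\<^sup>\<dagger> = B * Y" "(Y * B)\<^sup>\<dagger> = Y * B"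
proof -
  show "B * Y * B = E"
    unfolding B_mult_Y unfolding B_def E_def by (simp add: mult_blocks)
  have "Y * B * Y = Y * (B * Y)"
    by (rule assoc_mult_mat[OF Y_carrier B_carrier Y_carrier])
  then show "Y * B * Y = Y"
    unfolding B_mult_Y by (simp add: Y_def mult_blocks)
  show "(B * Y)\<^sup>\<dagger> = B * Y"
    unfolding B_mult_Y
    by (simp add: ctranspose_four_block[of _ r r _ p _ p])
  show "(Y * B)\<^sup>\<dagger> = Y * B"
    unfolding Y_mult_B
    by (simp add: ctranspose_four_block[of _ r r _ p _ p] ctranspose_mult)
qed

section \<open>The six characterizations in block form\<close>

lemma K_unitary:
  assumes "L = 0\<^sub>m r p"
  shows "K * K\<^sup>\<dagger> = 1\<^sub>m r" "K\<^sup>\<dagger> * K = 1\<^sub>m r"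
proof -
  show "K * K\<^sup>\<dagger> = 1\<^sub>m r"
    using KKLL by (simp add: assms)
  \<comment> \<open>\<open>K\<close> is square, so a one-sided inverse is two-sided even over the
    dual numbers.\<close>
  then show "K\<^sup>\<dagger> * K = 1\<^sub>m r"
    by (rule mat_left_inverse_if_right_inverse[rotated 2]) simp_all
qed

lemma hermitian_iff:
  "B\<^sup>\<dagger> = B \<longleftrightarrow> K\<^sup>\<dagger> * S = S * K \<and> (std_mat N)\<^sup>\<dagger> * dual_mat T = dual_mat T * std_mat N \<and>
    L = eps_mat (std_mat Si * (std_mat M)\<^sup>\<dagger> * dual_mat T)"
proof -
  have "N\<^sup>\<dagger> * T = T * N \<longleftrightarrow>
      N\<^sup>\<dagger> * eps_mat (dual_mat T) = eps_mat (dual_mat T) * N"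
    using T_inf by simp
  also have "\<dots> \<longleftrightarrow> (std_mat N)\<^sup>\<dagger> * dual_mat T = dual_mat T * std_mat N"
    by (simp add: eps_mat_mult_right eps_mat_mult_left ctranspose_parts)
  finally have N: "N\<^sup>\<dagger> * T = T * N \<longleftrightarrow> (std_mat N)\<^sup>\<dagger> * dual_mat T = dual_mat T * std_mat N" .
  \<comment> \<open>Solving the upper right block equation for \<open>L\<close> shows that
    \<open>L\<close> has to be infinitesimal.\<close>
  have "Si * (M\<^sup>\<dagger> * T) = Si * M\<^sup>\<dagger> * eps_mat (dual_mat T)"
    using T_inf by (simp add: mult_mat_assoc)
  also have "\<dots> = eps_mat (std_mat Si * (std_mat M)\<^sup>\<dagger> * dual_mat T)"
    by (simp add: eps_mat_mult_left ctranspose_parts std_mat_mult)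
  finally have L: "M\<^sup>\<dagger> * T = S * L \<longleftrightarrow> L = eps_mat (std_mat Si * (std_mat M)\<^sup>\<dagger> * dual_mat T)"
    by (metis S_Si_mult dims(9) index_mult_mat(2) ctranspose_dims(1) dims(12))
  \<comment> \<open>The lower left block equation is the adjoint of the upper right one and adds no
    condition.\<close>
  have "L\<^sup>\<dagger> * S = T * M \<longleftrightarrow> M\<^sup>\<dagger> * T = S * L"
    using ctranspose_inject[of "L\<^sup>\<dagger> * S" "T * M"] by (auto simp: ctranspose_mult)
  then show ?thesis
    unfolding B_ctranspose unfolding B_def
    by (subst blocks_inject) (auto simp: N L)
qed

text \<open>The right block column of the equation reads: the adjoint of Q times \<open>L\<close> is
  zero, so \<open>L\<close> cancels to zero. Conversely, \<open>L = 0\<close> makes \<open>K\<close>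
  unitary and both projectors equal to the one onto the first \<open>r\<close> coordinates.\<close>

lemma EP_iff: "B * Y = Y * B \<longleftrightarrow> L = 0\<^sub>m r p"
proof
  assume "B * Y = Y * B"
  then have eq: "K\<^sup>\<dagger> * K = 1\<^sub>m r" "K\<^sup>\<dagger> * L = 0\<^sub>m r p" "L\<^sup>\<dagger> * L = 0\<^sub>m p p"
    unfolding B_mult_Y Y_mult_B by (simp_all add: blocks_inject)
  show "L = 0\<^sub>m r p"
    by (rule KL_cancel) (simp_all add: eq)
next
  assume L: "L = 0\<^sub>m r p"
  show "B * Y = Y * B"
    unfolding B_mult_Y Y_mult_B by (simp add: K_unitary[OF L]) (simp add: L)
qed

text \<open>One product has the single nonzero block \<open>S * S\<close>; the other is the adjoint
  of Q times \<open>S * S\<close> times Q, as the terms with two factors \<open>T\<close> vanish.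
  Cancelling the adjoint of Q in the right block column gives \<open>L = 0\<close>; multiplying the
  left one by Q gives the commutation rule.\<close>

lemma normal_iff: "B * B\<^sup>\<dagger> = B\<^sup>\<dagger> * B \<longleftrightarrow> L = 0\<^sub>m r p \<and> S * S * K = K * (S * S)"
proof -
  have "S * (K * (K\<^sup>\<dagger> * S)) + S * (L * (L\<^sup>\<dagger> * S)) = S * S"
    by (simp add: KKLL_mult flip: mult_mat_add_right)
  moreover have "S * (K * (M\<^sup>\<dagger> * T)) + S * (L * (N\<^sup>\<dagger> * T)) = 0\<^sub>m r p"
    by (simp add: KMLN_mult flip: mult_mat_add_right)
  moreover have "T * (M * (K\<^sup>\<dagger> * S)) + T * (N * (L\<^sup>\<dagger> * S)) = 0\<^sub>m p r"
    by (simp add: MKNL_mult flip: mult_mat_add_right)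
  moreover have "T * (M * (M\<^sup>\<dagger> * T)) = 0\<^sub>m p p" "T * (N * (N\<^sup>\<dagger> * T)) = 0\<^sub>m p p"
    using T_mult_mult_T[of "M * M\<^sup>\<dagger>"] T_mult_mult_T[of "N * N\<^sup>\<dagger>"] by (simp_all add: mult_mat_assoc)
  ultimately have BB: "B * B\<^sup>\<dagger> = four_block_mat (S * S) (0\<^sub>m r p) (0\<^sub>m p r) (0\<^sub>m p p)"
    unfolding B_ctranspose unfolding B_def by (simp add: mult_blocks mult_mat_assoc)
  have "T * (T * M) = 0\<^sub>m p r" "T * (T * N) = 0\<^sub>m p p"
    by (simp_all flip: mult_mat_assoc)
  then have B'B: "B\<^sup>\<dagger> * B = four_block_mat (K\<^sup>\<dagger> * (S * (S * K))) (K\<^sup>\<dagger> * (S * (S * L)))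
      (L\<^sup>\<dagger> * (S * (S * K))) (L\<^sup>\<dagger> * (S * (S * L)))"
    unfolding B_ctranspose unfolding B_def by (simp add: mult_blocks mult_mat_assoc)
  show ?thesis
  proof
    assume "B * B\<^sup>\<dagger> = B\<^sup>\<dagger> * B"
    then have eq: "K\<^sup>\<dagger> * (S * (S * K)) = S * S" "K\<^sup>\<dagger> * (S * (S * L)) = 0\<^sub>m r p"
      "L\<^sup>\<dagger> * (S * (S * K)) = 0\<^sub>m p r" "L\<^sup>\<dagger> * (S * (S * L)) = 0\<^sub>m p p"
      unfolding BB B'B by (simp_all add: blocks_inject)
    have "S * (S * L) = S * (S * 0\<^sub>m r p)"
      by (rule KL_cancel) (simp_all add: eq)
    then have "L = 0\<^sub>m r p"
      by (rule S_cancel[OF S_cancel]) simp_all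
    moreover have "S * (S * K) = K * (S * S)"
      using KKLL_mult[of "S * (S * K)"] by (simp add: eq)
    ultimately show "L = 0\<^sub>m r p \<and> S * S * K = K * (S * S)"
      by (simp add: mult_mat_assoc)
  next
    assume *: "L = 0\<^sub>m r p \<and> S * S * K = K * (S * S)"
    then have "K\<^sup>\<dagger> * (S * (S * K)) = S * S"
      using K_unitary by (simp add: mult_mat_assoc mult_mat_inverse_cancel[where n = r])
    with * show "B * B\<^sup>\<dagger> = B\<^sup>\<dagger> * B"
      unfolding BB B'B by simp
  qed
qed

text \<open>The left block columns differ only in \<open>S\<close> against \<open>Si\<close> behind
  the adjoint of Q, and the right one of \<open>Y\<close> is zero.\<close>

lemma ctranspose_eq_Y_iff:
  "B\<^sup>\<dagger> = Y \<longleftrightarrow> T * M = 0\<^sub>m p r \<and> T * N = 0\<^sub>m p p \<and> S * S = 1\<^sub>m r"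
proof -
  have "K\<^sup>\<dagger> * S = K\<^sup>\<dagger> * Si \<and> L\<^sup>\<dagger> * S = L\<^sup>\<dagger> * Si \<longleftrightarrow> S = Si"
    by (auto dest: KL_cancel)
  moreover have "S = Si \<longleftrightarrow> S * S = 1\<^sub>m r"
    by (metis S_Si S_cancel dims(1,3))
  moreover have "M\<^sup>\<dagger> * T = 0\<^sub>m r p \<longleftrightarrow> T * M = 0\<^sub>m p r" "N\<^sup>\<dagger> * T = 0\<^sub>m p p \<longleftrightarrow> T * N = 0\<^sub>m p p"
    using ctranspose_inject[of "M\<^sup>\<dagger> * T" "0\<^sub>m r p"] ctranspose_inject[of "N\<^sup>\<dagger> * T" "0\<^sub>m p p"]
    by (auto simp: ctranspose_mult)
  ultimately show ?thesis
    unfolding B_ctranspose Y_def by (subst blocks_inject) auto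
qed

lemma idempotent_iff: "Y * Y = Y \<longleftrightarrow> S = K"
proof -
  have "Y * Y = four_block_mat (K\<^sup>\<dagger> * (Si * (K\<^sup>\<dagger> * Si))) (0\<^sub>m r p) (L\<^sup>\<dagger> * (Si * (K\<^sup>\<dagger> * Si))) (0\<^sub>m p p)"
    unfolding Y_def by (simp add: mult_blocks mult_mat_assoc)
  then have "Y * Y = Y \<longleftrightarrow> K\<^sup>\<dagger> * (Si * (K\<^sup>\<dagger> * Si)) = K\<^sup>\<dagger> * Si \<and> L\<^sup>\<dagger> * (Si * (K\<^sup>\<dagger> * Si)) = L\<^sup>\<dagger> * Si"
    unfolding Y_def by (simp add: blocks_inject)
  \<comment> \<open>\<open>KL_cancel\<close> removes the adjoint of Q; the factor
    \<open>1\<^sub>m r\<close> gives both sides the shape that \<open>Si_cancel\<close>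
    expects.\<close>
  also have "\<dots> \<longleftrightarrow> Si * (K\<^sup>\<dagger> * Si) = Si * 1\<^sub>m r"
    by (auto dest: KL_cancel)
  also have "\<dots> \<longleftrightarrow> K\<^sup>\<dagger> * Si = 1\<^sub>m r"
    using Si_cancel[of "K\<^sup>\<dagger> * Si" "1\<^sub>m r"] by auto
  also have "\<dots> \<longleftrightarrow> K\<^sup>\<dagger> = S"
  proof
    assume "K\<^sup>\<dagger> * Si = 1\<^sub>m r"
    from arg_cong[OF this, of "\<lambda>Z. Z * S"] show "K\<^sup>\<dagger> = S"
      by (simp add: mult_mat_assoc)
  qed simp
  also have "\<dots> \<longleftrightarrow> S = K"
    using ctranspose_inject[of K S] by auto
  finally show ?thesis .
qed

text \<open>The right block columns give \<open>M\<^sup>\<dagger> * T = 0\<close>. In the left ones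
  the excess term is the adjoint of P times \<open>T * (L\<^sup>\<dagger> * Si)\<close>;
  multiplication by Q kills it and leaves the condition on \<open>K\<close> and \<open>S\<close>.
  With this condition the excess term itself must be zero, which is the condition on
  \<open>N\<close>.\<close>

lemma ctranspose_commute_iff:
  "Y * B\<^sup>\<dagger> = B\<^sup>\<dagger> * Y \<longleftrightarrow>
    T * M = 0\<^sub>m p r \<and> L * T * N = 0\<^sub>m r p \<and> S * S * K = K * (S * S)"
proof -
  have YB: "Y * B\<^sup>\<dagger> = four_block_mat (K\<^sup>\<dagger> * (Si * (K\<^sup>\<dagger> * S))) (K\<^sup>\<dagger> * (Si * (M\<^sup>\<dagger> * T)))
      (L\<^sup>\<dagger> * (Si * (K\<^sup>\<dagger> * S))) (L\<^sup>\<dagger> * (Si * (M\<^sup>\<dagger> * T)))"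
    unfolding B_ctranspose Y_def by (simp add: mult_blocks mult_mat_assoc)
  have BY: "B\<^sup>\<dagger> * Y = four_block_mat (K\<^sup>\<dagger> * (S * (K\<^sup>\<dagger> * Si)) + M\<^sup>\<dagger> * (T * (L\<^sup>\<dagger> * Si))) (0\<^sub>m r p)
      (L\<^sup>\<dagger> * (S * (K\<^sup>\<dagger> * Si)) + N\<^sup>\<dagger> * (T * (L\<^sup>\<dagger> * Si))) (0\<^sub>m p p)"
    unfolding B_ctranspose Y_def by (simp add: mult_blocks mult_mat_assoc)
  have "M\<^sup>\<dagger> * T = 0\<^sub>m r p \<longleftrightarrow> T * M = 0\<^sub>m p r"
    using ctranspose_inject[of "M\<^sup>\<dagger> * T" "0\<^sub>m r p"] by (auto simp: ctranspose_mult)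
  moreover have "N\<^sup>\<dagger> * (T * L\<^sup>\<dagger>) = 0\<^sub>m p r \<longleftrightarrow> L * T * N = 0\<^sub>m r p"
    using ctranspose_inject[of "N\<^sup>\<dagger> * (T * L\<^sup>\<dagger>)" "0\<^sub>m p r"] by (auto simp: ctranspose_mult)
  moreover have "S * S * K\<^sup>\<dagger> = K\<^sup>\<dagger> * (S * S) \<longleftrightarrow> S * S * K = K * (S * S)"
    using ctranspose_inject[of "S * S * K\<^sup>\<dagger>" "K\<^sup>\<dagger> * (S * S)"] by (auto simp: ctranspose_mult)
  \<comment> \<open>Multiplying by \<open>S\<close> on both sides, respectively by
    \<open>Si\<close>, passes between the two forms.\<close>
  moreover have "Si * (K\<^sup>\<dagger> * S) = S * (K\<^sup>\<dagger> * Si) \<longleftrightarrow> S * S * K\<^sup>\<dagger> = K\<^sup>\<dagger> * (S * S)"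
  proof
    assume "Si * (K\<^sup>\<dagger> * S) = S * (K\<^sup>\<dagger> * Si)"
    from arg_cong[OF this, of "\<lambda>Z. S * (Z * S)"] show "S * S * K\<^sup>\<dagger> = K\<^sup>\<dagger> * (S * S)"
      by (simp add: mult_mat_assoc)
  next
    assume "S * S * K\<^sup>\<dagger> = K\<^sup>\<dagger> * (S * S)"
    from arg_cong[OF this, of "\<lambda>Z. Si * (Z * Si)"] show "Si * (K\<^sup>\<dagger> * S) = S * (K\<^sup>\<dagger> * Si)"
      by (simp add: mult_mat_assoc)
  qed
  moreover have "Y * B\<^sup>\<dagger> = B\<^sup>\<dagger> * Y \<longleftrightarrow> M\<^sup>\<dagger> * T = 0\<^sub>m r p \<and> N\<^sup>\<dagger> * (T * L\<^sup>\<dagger>) = 0\<^sub>m p r \<and>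
    Si * (K\<^sup>\<dagger> * S) = S * (K\<^sup>\<dagger> * Si)"
  proof
    assume "Y * B\<^sup>\<dagger> = B\<^sup>\<dagger> * Y"
    then have eq: "K\<^sup>\<dagger> * (Si * (M\<^sup>\<dagger> * T)) = 0\<^sub>m r p" "L\<^sup>\<dagger> * (Si * (M\<^sup>\<dagger> * T)) = 0\<^sub>m p p"
      "K\<^sup>\<dagger> * (Si * (K\<^sup>\<dagger> * S)) = K\<^sup>\<dagger> * (S * (K\<^sup>\<dagger> * Si)) + M\<^sup>\<dagger> * (T * (L\<^sup>\<dagger> * Si))"
      "L\<^sup>\<dagger> * (Si * (K\<^sup>\<dagger> * S)) = L\<^sup>\<dagger> * (S * (K\<^sup>\<dagger> * Si)) + N\<^sup>\<dagger> * (T * (L\<^sup>\<dagger> * Si))"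
      unfolding YB BY by (simp_all add: blocks_inject)
    have "Si * (M\<^sup>\<dagger> * T) = Si * 0\<^sub>m r p"
      by (rule KL_cancel) (simp_all add: eq)
    then have M: "M\<^sup>\<dagger> * T = 0\<^sub>m r p"
      by (rule Si_cancel) simp_all
    then have "M\<^sup>\<dagger> * (T * (L\<^sup>\<dagger> * Si)) = 0\<^sub>m r r"
      by (simp flip: mult_mat_assoc)
    with eq have K1: "K\<^sup>\<dagger> * (Si * (K\<^sup>\<dagger> * S)) = K\<^sup>\<dagger> * (S * (K\<^sup>\<dagger> * Si))"
      by simp
    \<comment> \<open>Q times the adjoint of P is zero and the summand with \<open>M\<close> has
      already vanished, so the summand with \<open>N\<close> vanishes too.\<close>
    have LN: "L * (N\<^sup>\<dagger> * (T * (L\<^sup>\<dagger> * Si))) = 0\<^sub>m r r"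
      using KMLN_mult[of "T * (L\<^sup>\<dagger> * Si)"] \<open>M\<^sup>\<dagger> * (T * (L\<^sup>\<dagger> * Si)) = 0\<^sub>m r r\<close> by simp
    have K2: "Si * (K\<^sup>\<dagger> * S) = S * (K\<^sup>\<dagger> * Si)"
    proof -
      have "Si * (K\<^sup>\<dagger> * S) = K * (K\<^sup>\<dagger> * (Si * (K\<^sup>\<dagger> * S))) + L * (L\<^sup>\<dagger> * (Si * (K\<^sup>\<dagger> * S)))"
        by (rule KKLL_mult[symmetric]) simp
      also have "\<dots> = K * (K\<^sup>\<dagger> * (S * (K\<^sup>\<dagger> * Si))) + L * (L\<^sup>\<dagger> * (S * (K\<^sup>\<dagger> * Si)))"
        unfolding K1 eq(4) by (simp add: mult_mat_add_right LN)
      also have "\<dots> = S * (K\<^sup>\<dagger> * Si)"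
        by (rule KKLL_mult) simp
      finally show ?thesis .
    qed
    have "N\<^sup>\<dagger> * (T * (L\<^sup>\<dagger> * Si)) = 0\<^sub>m p r"
    proof -
      \<comment> \<open>Given \<open>K2\<close>, the lower left block equation reads
        \<open>C = C + D\<close>; cancelling \<open>C\<close> entrywise leaves
        \<open>D = 0\<close>.\<close>
      define C D where "C = L\<^sup>\<dagger> * (S * (K\<^sup>\<dagger> * Si))" and "D = N\<^sup>\<dagger> * (T * (L\<^sup>\<dagger> * Si))"
      have CD: "C \<in> carrier_mat p r" "D \<in> carrier_mat p r"
        by (simp_all add: C_def D_def)
      have "C = C + D"
        using eq(4) K2 by (simp add: C_def D_def)
      then have "C $$ (i, j) = C $$ (i, j) + D $$ (i, j)" if "i < p" "j < r" for i j
        using that CD by (metis carrier_matD index_add_mat(1))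
      then show ?thesis
        unfolding D_def[symmetric] using CD by (intro eq_matI) auto
    qed
    from arg_cong[OF this, of "\<lambda>Z. Z * S"] have "N\<^sup>\<dagger> * (T * L\<^sup>\<dagger>) = 0\<^sub>m p r"
      by (simp add: mult_mat_assoc)
    with M K2 show "M\<^sup>\<dagger> * T = 0\<^sub>m r p \<and> N\<^sup>\<dagger> * (T * L\<^sup>\<dagger>) = 0\<^sub>m p r \<and>
      Si * (K\<^sup>\<dagger> * S) = S * (K\<^sup>\<dagger> * Si)" by blast
  next
    assume *: "M\<^sup>\<dagger> * T = 0\<^sub>m r p \<and> N\<^sup>\<dagger> * (T * L\<^sup>\<dagger>) = 0\<^sub>m p r \<and> Si * (K\<^sup>\<dagger> * S) = S * (K\<^sup>\<dagger> * Si)"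
    have "M\<^sup>\<dagger> * (T * (L\<^sup>\<dagger> * Si)) = M\<^sup>\<dagger> * T * (L\<^sup>\<dagger> * Si)"
      "N\<^sup>\<dagger> * (T * (L\<^sup>\<dagger> * Si)) = N\<^sup>\<dagger> * (T * L\<^sup>\<dagger>) * Si"
      by (simp_all add: mult_mat_assoc)
    then have "M\<^sup>\<dagger> * (T * (L\<^sup>\<dagger> * Si)) = 0\<^sub>m r r" "N\<^sup>\<dagger> * (T * (L\<^sup>\<dagger> * Si)) = 0\<^sub>m p r"
      using * by simp_all
    with * show "Y * B\<^sup>\<dagger> = B\<^sup>\<dagger> * Y"
      unfolding YB BY by simp
  qed
  ultimately show ?thesis by blast
qed

end

end

section \<open>Transfer from the block form to \<open>A\<close>\<close>

theorem theorem3p4: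
  fixes n r :: nat
    and A U K L M N :: "complex dual mat"
    and S1 S2 :: "real dual mat"
  assumes "A \<in> carrier_mat n n"
    and "hs_decomposition n r A U S1 S2 K L M N"
  shows
    "(hermitian_mat A \<longleftrightarrow>
        K\<^sup>\<dagger> * cmat S1 = cmat S1 * K \<and>
        (std_mat N)\<^sup>\<dagger> * dual_mat (cmat S2) = dual_mat (cmat S2) * std_mat N \<and>
        L = eps_mat (the (mat_inverse (std_mat (cmat S1))) * (std_mat M)\<^sup>\<dagger> * dual_mat (cmat S2)))
     \<and> (new_dual_EP A \<longleftrightarrow> L = 0\<^sub>m r (n - r))
     \<and> (normal_mat A \<longleftrightarrow> L = 0\<^sub>m r (n - r) \<and> cmat S1 * K = K * cmat S1)
     \<and> (A\<^sup>\<dagger> = A\<^sup>N \<longleftrightarrow>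
        dual_mat (cmat S2) * std_mat M = 0\<^sub>m (n - r) r \<and>
        dual_mat (cmat S2) * std_mat N = 0\<^sub>m (n - r) (n - r) \<and>
        S1 = 1\<^sub>m r)
     \<and> (idempotent_mat (A\<^sup>N) \<longleftrightarrow> cmat S1 = K)
     \<and> (A\<^sup>N * A\<^sup>\<dagger> = A\<^sup>\<dagger> * A\<^sup>N \<longleftrightarrow>
        dual_mat (cmat S2) * std_mat M = 0\<^sub>m (n - r) r \<and>
        std_mat L * dual_mat (cmat S2) * std_mat N = 0\<^sub>m r (n - r) \<and>
        cmat S1 * cmat S1 * K = K * (cmat S1 * cmat S1))"
proof -
  note hs = assms(2)[unfolded hs_decomposition_def]
  have S1: "appreciable_diag r S1" and S2: "infinitesimal_diag (n - r) (n - r) S2"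
    and U: "unitary_mat n U" and r: "r + (n - r) = n"
    using hs by auto
  have S1c: "diagonal_mat S1" "S1 \<in> carrier_mat r r"
    and S2c: "diagonal_mat S2" "S2 \<in> carrier_mat (n - r) (n - r)"
    using S1 S2 by (auto simp: appreciable_diag_def infinitesimal_diag_def)
  obtain Si where Si: "Si \<in> carrier_mat r r" "cmat S1 * Si = 1\<^sub>m r" "Si * cmat S1 = 1\<^sub>m r"
    using appreciable_diag_inverse[OF S1] by blast
  interpret hs_blocks r "n - r" "cmat S1" Si "cmat S2" K L M N
  proof
    show "cmat S1 \<in> carrier_mat r r" "cmat S2 \<in> carrier_mat (n - r) (n - r)"
      using S1c S2c by auto
    show "(cmat S1)\<^sup>\<dagger> = cmat S1" "(cmat S2)\<^sup>\<dagger> = cmat S2"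
      using S1c S2c by (auto intro: ctranspose_cmat_diagonal)
    show "cmat S2 = eps_mat (dual_mat (cmat S2))"
      using infinitesimal_diag_eps_mat[OF S2] by simp
  qed (use Si hs in auto)
  \<comment> \<open>Since \<open>r \<le> n\<close>, the block size \<open>r + (n - r)\<close> is
    \<open>n\<close>, which makes the blocks conformable with \<open>U\<close>.\<close>
  have carriers [simp]: "B \<in> carrier_mat n n" "E \<in> carrier_mat n n" "Y \<in> carrier_mat n n"
    using B_carrier E_carrier Y_carrier unfolding r by blast+
  have Bt [simp]: "B\<^sup>\<dagger> \<in> carrier_mat n n"
    by simp
  have A: "A = U * B * U\<^sup>\<dagger>" and ess: "essential_part A = U * E * U\<^sup>\<dagger>"
    using hs unfolding B_def E_def by blast+
  have At: "A\<^sup>\<dagger> = U * B\<^sup>\<dagger> * U\<^sup>\<dagger>"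
    unfolding A by (rule unitary_conj_ctranspose[OF U]) simp
  note conj_mult = unitary_conj_mult[OF U] and conj_inject = unitary_conj_inject[OF U]
    and conj_ctr = unitary_conj_ctranspose[OF U]
  \<comment> \<open>Conjugation by \<open>U\<close> preserves the four defining equations, and
    uniqueness identifies the definite description.\<close>
  have X: "A\<^sup>N = U * Y * U\<^sup>\<dagger>"
  proof (rule ndmpi_eqI)
    have "U * Y * U\<^sup>\<dagger> \<in> carrier_mat n n"
      using U by (auto simp: unitary_mat_def)
    then show "is_ndmpi A (U * Y * U\<^sup>\<dagger>)"
      unfolding is_ndmpi_def ess carrier_matD[OF assms(1)] unfolding A
      by (simp add: conj_mult conj_ctr ndmpi_blocks mult_carrier_mat[of _ n n] del: assoc_mult_mat)
  qed
  \<comment> \<open>Taking standard parts is multiplicative, so the standard part of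
    \<open>Si\<close> inverts that of \<Sigma>1.\<close>
  have std_inv: "the (mat_inverse (std_mat (cmat S1))) = std_mat Si"
  proof -
    have "mat_inverse (std_mat (cmat S1)) = Some (std_mat Si)"
    proof (rule mat_inverse_eqI)
      show "std_mat (cmat S1) * std_mat Si = 1\<^sub>m r" "std_mat Si * std_mat (cmat S1) = 1\<^sub>m r"
        using Si S1c by (simp_all flip: std_mat_mult)
    qed (use Si S1c in auto)
    then show ?thesis by simp
  qed
  have "hermitian_mat A \<longleftrightarrow> B\<^sup>\<dagger> = B"
    unfolding hermitian_mat_def At unfolding A by (simp add: conj_inject)
  moreover have "new_dual_EP A \<longleftrightarrow> B * Y = Y * B"
    unfolding new_dual_EP_def X unfolding A
    by (simp add: conj_mult conj_inject mult_carrier_mat[of _ n n] del: assoc_mult_mat)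
  moreover have "normal_mat A \<longleftrightarrow> B * B\<^sup>\<dagger> = B\<^sup>\<dagger> * B"
    unfolding normal_mat_def At unfolding A
    by (simp add: conj_mult conj_inject mult_carrier_mat[of _ n n] del: assoc_mult_mat)
  moreover have "A\<^sup>\<dagger> = A\<^sup>N \<longleftrightarrow> B\<^sup>\<dagger> = Y"
    unfolding At X by (simp add: conj_inject)
  moreover have "idempotent_mat (A\<^sup>N) \<longleftrightarrow> Y * Y = Y"
    unfolding idempotent_mat_def X
    by (simp add: conj_mult conj_inject mult_carrier_mat[of _ n n] del: assoc_mult_mat)
  moreover have "A\<^sup>N * A\<^sup>\<dagger> = A\<^sup>\<dagger> * A\<^sup>N \<longleftrightarrow> Y * B\<^sup>\<dagger> = B\<^sup>\<dagger> * Y"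
    unfolding At X
    by (simp add: conj_mult conj_inject mult_carrier_mat[of _ n n] del: assoc_mult_mat)
  \<comment> \<open>Positivity of the diagonal of \<Sigma>1 allows square roots to be taken:
    commuting with the square becomes commuting with \<Sigma>1 for normality, and a square equal to
    the identity becomes \<open>S1 = 1\<^sub>m r\<close>.\<close>
  ultimately show ?thesis
    using hermitian_iff EP_iff normal_iff ctranspose_eq_Y_iff idempotent_iff ctranspose_commute_iff
      appreciable_diag_square_commute[OF S1 carr(4)] appreciable_diag_square_eq_one[OF S1]
      T_mult_eq_0[of M r] T_mult_eq_0[of N "n - r"] LTN_eq_0 std_inv
    by (simp only: dims)
qed

end
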